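(* Let $\mathrm{V}$ be a finite vertex set, let $\mathfrak{G}$ be the class of all directed acyclic graphs (DAGs) over $\mathrm{V}$, and let $\mathcal{L}=(\mathfrak{G},\preceq)$ be the poset with $\mathcal{D}_1\preceq\mathcal{D}_2$ if and only if $\mathcal{M}^{\mathrm{c}}_{\mathrm{DAG}}(\mathcal{D}_1)\subseteq\mathcal{M}^{\mathrm{c}}_{\mathrm{DAG}}(\mathcal{D}_2)$. Then: 1. The least element of $\mathcal{L}$ is the empty graph. There is no greatest element when $|\mathrm{V}|>1$. 2. $\mathcal{L}$ is graded with $\mathrm{rank}(\mathcal{D})$ equal to the number of edges of $\mathcal{D}$. 3. $\mathcal{D}_1\lessdot\mathcal{D}_2$ if and only if $\mathcal{D}_1$ is a subgraph of $\mathcal{D}_2$ with exactly one fewer edge. 4. $\mathcal{L}$ is a meet semi-lattice. 5. $\mathcal{L}$ is lower semimodular.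
   Context: Causal model. For each $v\in\mathrm{V}$ let $\mathcal{X}_v$ be a state space, infinite or finite with at least two elements; $\mathcal{X}_{\mathrm{I}}=\prod_{v\in\mathrm{I}}\mathcal{X}_v$ for $\mathrm{I}\subseteq\mathrm{V}$, and $\mathcal{X}=\mathcal{X}_{\mathrm{V}}$ is equipped with a suitable product $\sigma$-algebra. The potential outcome schedule is the stochastic process $X(\cdot)=(X_v(x_{\mathrm{I}}):v\in\mathrm{V},\mathrm{I}\subseteq\mathrm{V},x_{\mathrm{I}}\in\mathcal{X}_{\mathrm{I}})$, where the $\mathcal{X}_v$-valued $X_v(x_{\mathrm{I}})$ is the potential outcome of variable $v$ under the intervention imposing $x_{\mathrm{I}}$ on $X_{\mathrm{I}}$. The space in which $X(\cdot)$ takes values is assumed to carry a suitable $\sigma$-algebra; $P$ denotes the law of $X(\cdot)$ and is assumed to admit the regular conditional probability distributions used below. Write $X_{\mathrm{J}}(x_{\mathrm{I}})=(X_v(x_{\mathrm{I}}))_{v\in\mathrm{J}}$ and $X(x_{\mathrm{I}})=X_{\mathrm{V}}(x_{\mathrm{I}})$. The ground causal model $\mathcal{M}^{\mathrm{c}}$ is the set of laws $P$ satisfying consistency: for all disjoint $\mathrm{I},\mathrm{I}'\subseteq\mathrm{V}$ and each $x\in\mathcal{X}$, $P\big(X(x_{\mathrm{I}},x_{\mathrm{I}'})=X(x_{\mathrm{I}})\mid X_{\mathrm{I}'}(x_{\mathrm{I}})=x_{\mathrm{I}'}\big)=1$. For a DAG $\mathcal{D}$ with parent sets $\mathrm{Pa}(v)=\{w:w\to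 v\}$, $\mathcal{M}^{\mathrm{c}}_{\mathrm{DAG}}(\mathcal{D})$ is the set of $P\in\mathcal{M}^{\mathrm{c}}$ such that: (i) for every $v\in\mathrm{V}$, $\mathrm{I}\subseteq\mathrm{V}$ and $x\in\mathcal{X}$, $P\big\{X_v(x_{\mathrm{I}})=X_v\big(x_{\mathrm{Pa}(v)\cap\mathrm{I}},X_{\mathrm{Pa}(v)\setminus\mathrm{I}}(x_{\mathrm{I}})\big)\big\}=1$; (iii) for every $x\in\mathcal{X}$, the variables $(X_v(x_{\mathrm{Pa}(v)}):v\in\mathrm{V})$ are mutually independent under $P$. Poset terms: $x\lessdot y$ ($y$ covers $x$) if $x\prec y$ with nothing strictly between. A poset is connected if any two elements are joined by a sequence whose consecutive elements are in a covering relation. A connected poset is graded with rank function $\mathrm{rank}:\mathfrak{G}\to\mathbb{N}$ if $x\lessdot y$ implies $\mathrm{rank}(y)=\mathrm{rank}(x)+1$, and $\mathrm{rank}(x)=0$ for some minimal $x$. Meet semi-lattice: every two elements have a greatest lower bound. Lower semimodular: whenever $z$ covers $x$ and $y$ with $x\ne y$, some $w$ is covered by both $x$ and $y$. A subgraph here is over the same vertex set with a subset of the directed edges.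
   Formalization: The "suitable" σ-algebra is made precise: singletons are measurable, outcomes are jointly measurable in the intervention, and laws are separable (countably many interventions decide whether two intervention sets always act alike on a variable); without separability the claim can fail. *)

theory Defs
  imports "HOL-Probability.Probability" "HOL-Algebra.Lattice"
begin

section \<open>Potential outcome schedules\<close>

text \<open>
  The state space of vertex \<open>v\<close> is the measurable space \<open>S v\<close>; the vertex set is the
  whole (finite) type \<open>'v\<close>. A schedule is a function on the index set of all triples
  \<open>(v, I, x\<^sub>I)\<close> with \<open>x\<^sub>I\<close> in the product of the state spaces over \<open>I\<close>.
\<close>

type_synonym ('v, 'a) schedule = "'v \<times> 'v set \<times> ('v \<Rightarrow> 'a) \<Rightarrow> 'a"

definition state_space :: "'a measure \<Rightarrow> bool" where
  "state_space M \<longleftrightarrow>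
     (infinite (space M) \<or> card (space M) \<ge> 2) \<and> (\<forall>a\<in>space M. {a} \<in> sets M)"

definition schedules :: "('v \<Rightarrow> 'a measure) \<Rightarrow> ('v, 'a) schedule set" where
  "schedules S =
     (\<Pi>\<^sub>E (v, I, x) \<in> (SIGMA v:UNIV. SIGMA I:UNIV. space (PiM I S)). space (S v))"

text \<open>
  \<open>outcome X v I x\<close> is \<open>X\<^sub>v(x\<^sub>I)\<close>: only the components of \<open>x\<close> in \<open>I\<close> matter.
  Membership \<open>v \<in> I\<close> does not force \<open>X\<^sub>v(x\<^sub>I) = x\<^sub>v\<close>.
\<close>

definition outcome :: "('v, 'a) schedule \<Rightarrow> 'v \<Rightarrow> 'v set \<Rightarrow> ('v \<Rightarrow> 'a) \<Rightarrow> 'a" where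
  "outcome X v I x = X (v, I, restrict x I)"

definition outcomes :: "('v, 'a) schedule \<Rightarrow> 'v set \<Rightarrow> 'v set \<Rightarrow> ('v \<Rightarrow> 'a) \<Rightarrow> 'v \<Rightarrow> 'a" where
  "outcomes X J I x = (\<lambda>v\<in>J. outcome X v I x)"

text \<open>
  A law is a probability measure carrying its own sample space of schedules and its own
  \<open>\<sigma>\<close>-algebra. No single choice would do: on the set of all schedules over real-valued state
  spaces, no \<open>\<sigma>\<close>-algebra makes the evaluation maps jointly measurable, and the product
  \<open>\<sigma>\<close>-algebra does not contain events about an outcome under a random intervention. The last
  conjunct is a separability condition in the sense of Doob: countably many interventions
  decide whether two intervention sets always have the same effect on \<open>v\<close>. It is automatic if
  the state spaces or the sample space are countable, or if the schedules are continuous in the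
  intervention and the state spaces are separable metric. Without it, enlarging the graph could
  shrink the model, since a statement holding almost surely for each fixed intervention could
  fail almost surely for a random one.
\<close>

definition schedule_law :: "('v \<Rightarrow> 'a measure) \<Rightarrow> ('v, 'a) schedule measure \<Rightarrow> bool" where
  "schedule_law S P \<longleftrightarrow>
     prob_space P \<and> space P \<subseteq> schedules S \<and>
     (\<forall>v I. (\<lambda>(X, x). outcome X v I x) \<in> P \<Otimes>\<^sub>M PiM I S \<rightarrow>\<^sub>M S v) \<and>
     (\<exists>C. countable C \<and> C \<subseteq> space (PiM UNIV S) \<and>
        (AE X in P. \<forall>v I J.
           (\<forall>x\<in>C. outcome X v I x = outcome X v J x) \<longrightarrow>
           (\<forall>x\<in>space (PiM UNIV S). outcome X v I x = outcome X v J x)))"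

section \<open>Causal models\<close>

definition regular_cond_prob ::
  "'b measure \<Rightarrow> 'c measure \<Rightarrow> ('b \<Rightarrow> 'c) \<Rightarrow> ('c \<Rightarrow> 'b measure) \<Rightarrow> bool" where
  "regular_cond_prob P M Y \<kappa> \<longleftrightarrow>
     \<kappa> \<in> M \<rightarrow>\<^sub>M prob_algebra P \<and>
     (\<forall>A\<in>sets P. \<forall>B\<in>sets M.
        emeasure P (A \<inter> (Y -` B \<inter> space P)) = (\<integral>\<^sup>+y\<in>B. emeasure (\<kappa> y) A \<partial>distr P M Y))"

text \<open>
  The value \<open>y\<close> plays the role of \<open>x\<^sub>I\<^sub>'\<close>. A regular conditional probability is determined
  only up to null sets of the conditioning variable, so the condition is imposed for almost every
  \<open>y\<close>; in the discrete case these are exactly the \<open>y\<close> of positive probability.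
\<close>

definition consistent :: "('v \<Rightarrow> 'a measure) \<Rightarrow> ('v, 'a) schedule measure \<Rightarrow> bool" where
  "consistent S P \<longleftrightarrow>
     (\<forall>I I'. I \<inter> I' = {} \<longrightarrow> (\<forall>x\<in>space (PiM UNIV S).
        \<exists>\<kappa>. regular_cond_prob P (PiM I' S) (\<lambda>X. outcomes X I' I x) \<kappa> \<and>
          (AE y in distr P (PiM I' S) (\<lambda>X. outcomes X I' I x).
             AE X in \<kappa> y.
               outcomes X UNIV (I \<union> I') (override_on x y I') = outcomes X UNIV I x)))"

definition ground_model :: "('v \<Rightarrow> 'a measure) \<Rightarrow> ('v, 'a) schedule measure set" where
  "ground_model S = {P. schedule_law S P \<and> consistent S P}"

definition parents :: "'v rel \<Rightarrow> 'v \<Rightarrow> 'v set" where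
  "parents D v = {w. (w, v) \<in> D}"

definition dag_model ::
  "('v \<Rightarrow> 'a measure) \<Rightarrow> 'v rel \<Rightarrow> ('v, 'a) schedule measure set" where
  "dag_model S D = {P \<in> ground_model S.
     (\<forall>v I. \<forall>x\<in>space (PiM UNIV S).
        AE X in P. outcome X v I x =
          outcome X v (parents D v)
            (override_on (outcomes X (parents D v - I) I x) x (parents D v \<inter> I))) \<and>
     (\<forall>x\<in>space (PiM UNIV S).
        prob_space.indep_vars P S (\<lambda>v X. outcome X v (parents D v) x) UNIV)}"

definition dag_poset :: "('v::finite \<Rightarrow> 'a measure) \<Rightarrow> 'v rel gorder" where
  "dag_poset S = \<lparr>carrier = {D. acyclic D}, eq = (=),
     le = (\<lambda>D\<^sub>1 D\<^sub>2. dag_model S D\<^sub>1 \<subseteq> dag_model S D\<^sub>2)\<rparr>"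

section \<open>Graded and lower semimodular posets\<close>

definition covered_by :: "('b, 'm) gorder_scheme \<Rightarrow> 'b \<Rightarrow> 'b \<Rightarrow> bool" where
  "covered_by L x y \<longleftrightarrow> x \<in> carrier L \<and> y \<in> carrier L \<and> x \<sqsubset>\<^bsub>L\<^esub> y \<and>
     \<not> (\<exists>z\<in>carrier L. x \<sqsubset>\<^bsub>L\<^esub> z \<and> z \<sqsubset>\<^bsub>L\<^esub> y)"

definition connected_poset :: "('b, 'm) gorder_scheme \<Rightarrow> bool" where
  "connected_poset L \<longleftrightarrow> partial_order L \<and>
     (\<forall>x\<in>carrier L. \<forall>y\<in>carrier L.
        (x, y) \<in> {(a, b). covered_by L a b \<or> covered_by L b a}\<^sup>*)"

definition graded_poset :: "('b, 'm) gorder_scheme \<Rightarrow> ('b \<Rightarrow> nat) \<Rightarrow> bool" where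
  "graded_poset L rk \<longleftrightarrow> connected_poset L \<and>
     (\<forall>x y. covered_by L x y \<longrightarrow> rk y = rk x + 1) \<and>
     (\<exists>x\<in>carrier L. \<not> (\<exists>y\<in>carrier L. y \<sqsubset>\<^bsub>L\<^esub> x) \<and> rk x = 0)"

definition lower_semimodular :: "('b, 'm) gorder_scheme \<Rightarrow> bool" where
  "lower_semimodular L \<longleftrightarrow>
     (\<forall>x y z. covered_by L x z \<and> covered_by L y z \<and> x \<noteq> y \<longrightarrow>
        (\<exists>w. covered_by L w x \<and> covered_by L w y))"

end

theory Submission
  imports Defs
begin

text \<open>
  The model order is edge inclusion. If \<open>D \<subseteq> E\<close>, then under the model of \<open>D\<close> fixing the larger
  parent set of a vertex has almost surely the same effect as fixing the smaller one, and
  separability makes this hold simultaneously for all interventions, in particular for random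
  ones. Conversely, if \<open>(u, v)\<close> is an edge of \<open>D\<close> but not of \<open>E\<close>, the deterministic schedule in
  which \<open>v\<close> reacts only to an intervention on \<open>u\<close> belongs to the model of \<open>{(u, v)}\<close>, hence to that
  of \<open>D\<close>, but not to that of \<open>E\<close>.
\<close>

section \<open>Larger graphs have larger models\<close>

text \<open>Independence is a property of the joint law and the marginals. Since \<open>I\<close> is
  countable, the exceptional null sets unite to one null set, so both families have the same joint
  law.\<close>

lemma (in prob_space) indep_vars_cong_AE:
  assumes X: "indep_vars N X I"
    and Y: "\<And>i. i \<in> I \<Longrightarrow> random_variable (N i) (Y i)"
    and I: "countable I"
    and eq: "\<And>i. i \<in> I \<Longrightarrow> AE \<omega> in M. X i \<omega> = Y i \<omega>"
  shows "indep_vars N Y I"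
\<comment> \<open>The characterisation of independence by a product law assumes a nonempty index
  set.\<close>
proof (cases "I = {}")
  case True
  then show ?thesis
    by (simp add: indep_vars_def indep_sets_def)
next
  case False
  have rv: "random_variable (N i) (X i)" if "i \<in> I" for i
    using X that by (simp add: indep_vars_def)
  have "AE \<omega> in M. \<forall>i\<in>I. X i \<omega> = Y i \<omega>"
    using eq I by (simp add: AE_ball_countable)
  then have "AE \<omega> in M. (\<lambda>i\<in>I. X i \<omega>) = (\<lambda>i\<in>I. Y i \<omega>)"
    by eventually_elim auto
  then have "distr M (\<Pi>\<^sub>M i\<in>I. N i) (\<lambda>\<omega>. \<lambda>i\<in>I. X i \<omega>) = distr M (\<Pi>\<^sub>M i\<in>I. N i) (\<lambda>\<omega>. \<lambda>i\<in>I. Y i \<omega>)"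
    by (intro distr_cong_AE measurable_restrict) (use rv Y in auto)
  moreover have "distr M (N i) (X i) = distr M (N i) (Y i)" if "i \<in> I" for i
    using eq that rv Y by (intro distr_cong_AE) auto
  ultimately show ?thesis
    using X rv Y False by (simp add: indep_vars_iff_distr_eq_PiM' cong: PiM_cong)
qed

lemma outcome_cong:
  "(\<And>w. w \<in> I \<Longrightarrow> x w = y w) \<Longrightarrow> outcome X v I x = outcome X v I y"
  by (simp add: outcome_def restrict_def fun_eq_iff) (metis (full_types))

lemma outcome_in_space:
  assumes "X \<in> schedules S" "\<And>w. w \<in> I \<Longrightarrow> x w \<in> space (S w)"
  shows "outcome X v I x \<in> space (S v)"
proof -
  have "restrict x I \<in> space (PiM I S)"
    using assms(2) by (auto simp: space_PiM)
  then show ?thesis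
    using assms(1) unfolding schedules_def outcome_def by (auto dest!: PiE_mem[where x="(v, I, restrict x I)"])
qed

text \<open>A section of the jointly measurable evaluation map at a fixed intervention. Restriction
  to \<open>I\<close> is needed because points of \<open>PiM I S\<close> are extensional.\<close>

lemma measurable_outcome:
  assumes "schedule_law S P" "x \<in> space (PiM UNIV S)"
  shows "(\<lambda>X. outcome X v I x) \<in> P \<rightarrow>\<^sub>M S v"
proof -
  have "restrict x I \<in> space (PiM I S)"
    using assms(2) by (auto simp: space_PiM)
  then have "(\<lambda>X. (X, restrict x I)) \<in> P \<rightarrow>\<^sub>M P \<Otimes>\<^sub>M PiM I S"
    by measurable
  moreover have "(\<lambda>(X, x). outcome X v I x) \<in> P \<Otimes>\<^sub>M PiM I S \<rightarrow>\<^sub>M S v"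
    using assms(1) by (simp add: schedule_law_def)
  ultimately have "(\<lambda>X. case (X, restrict x I) of (X, x) \<Rightarrow> outcome X v I x) \<in> P \<rightarrow>\<^sub>M S v"
    by (rule measurable_compose)
  then show ?thesis
    by (simp add: outcome_def)
qed

text \<open>Moves the quantifier over \<open>x\<close> inside the almost sure statement: the
  countably many exceptional sets for \<open>x\<close> in \<open>C\<close> have a null union, and
  separability extends the equality from \<open>C\<close> to every intervention.\<close>

lemma AE_outcome_eq_all:
  assumes P: "schedule_law S P"
    and eq: "\<And>x. x \<in> space (PiM UNIV S) \<Longrightarrow> AE X in P. outcome X v I x = outcome X v J x"
  shows "AE X in P. \<forall>x\<in>space (PiM UNIV S). outcome X v I x = outcome X v J x"
proof -
  obtain C where C: "countable C" "C \<subseteq> space (PiM UNIV S)"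
    and sep: "AE X in P. \<forall>v I J.
      (\<forall>x\<in>C. outcome X v I x = outcome X v J x) \<longrightarrow>
      (\<forall>x\<in>space (PiM UNIV S). outcome X v I x = outcome X v J x)"
    using P unfolding schedule_law_def by blast
  have "AE X in P. \<forall>x\<in>C. outcome X v I x = outcome X v J x"
    using C eq by (subst AE_ball_countable) auto
  with sep show ?thesis
    by eventually_elim blast
qed

lemma parents_mono: "D \<subseteq> E \<Longrightarrow> parents D v \<subseteq> parents E v"
  by (auto simp: parents_def)

text \<open>The ground model does not depend on the graph, so only recursion and independence have
  to be transferred. Both follow once interventions on the two parent sets of \<open>v\<close> have
  the same effect.\<close>

lemma dag_model_mono:
  fixes S :: "'v::finite \<Rightarrow> 'a measure"
  assumes "D \<subseteq> E"
  shows "dag_model S D \<subseteq> dag_model S E"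
proof
  fix P assume "P \<in> dag_model S D"
  then have ground: "P \<in> ground_model S"
    and rec: "\<And>v I x. x \<in> space (PiM UNIV S) \<Longrightarrow>
        AE X in P. outcome X v I x = outcome X v (parents D v)
          (override_on (outcomes X (parents D v - I) I x) x (parents D v \<inter> I))"
    and ind: "\<And>x. x \<in> space (PiM UNIV S) \<Longrightarrow>
        prob_space.indep_vars P S (\<lambda>v X. outcome X v (parents D v) x) UNIV"
    unfolding dag_model_def by blast+
  have law: "schedule_law S P"
    using ground by (simp add: ground_model_def)
  then interpret prob_space P
    by (simp add: schedule_law_def)
  have sub: "parents D v \<subseteq> parents E v" for v
    using assms by (rule parents_mono)
  \<comment> \<open>Recursion for \<open>D\<close> under an intervention on
    \<open>parents E v\<close>: all parents in \<open>D\<close> are imposed, so no random value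
    enters.\<close>
  have eq: "AE X in P. outcome X v (parents E v) x = outcome X v (parents D v) x"
    if x: "x \<in> space (PiM UNIV S)" for v x
  proof -
    have "outcome X v (parents D v)
        (override_on (outcomes X (parents D v - parents E v) (parents E v) x) x
          (parents D v \<inter> parents E v)) = outcome X v (parents D v) x" for X
      using sub[of v] by (intro outcome_cong) (auto simp: override_on_def)
    then show ?thesis
      using rec[OF x, of v "parents E v"] by simp
  qed
  have "AE X in P. outcome X v I x = outcome X v (parents E v)
      (override_on (outcomes X (parents E v - I) I x) x (parents E v \<inter> I))"
    if x: "x \<in> space (PiM UNIV S)" for v I x
  proof -
    have "AE X in P. X \<in> schedules S"
      using law by (auto simp: schedule_law_def)
    moreover have "AE X in P. \<forall>x\<in>space (PiM UNIV S).
        outcome X v (parents E v) x = outcome X v (parents D v) x"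
      by (intro AE_outcome_eq_all[OF law] eq)
    moreover note rec[OF x, of v I]
    ultimately show ?thesis
    proof eventually_elim
      case (elim X)
      \<comment> \<open>\<open>y\<close> has the imposed values on \<open>I\<close> and the
        resulting outcomes elsewhere. It depends on \<open>X\<close>, which is why the equality is
        needed for all interventions at once. It does not depend on a graph: its restriction to the
        parents of \<open>v\<close> in any \<open>G\<close> is the intervention in the recursion for
        \<open>G\<close>.\<close>
      define y where "y = override_on (outcomes X UNIV I x) x I"
      have "y \<in> space (PiM UNIV S)"
        using outcome_in_space[OF elim(1), of I x] x
        by (auto simp: y_def space_PiM override_on_def outcomes_def PiE_iff)
      then have "outcome X v (parents E v) y = outcome X v (parents D v) y"
        using elim(2) by blast
      moreover have "outcome X v (parents G v)
          (override_on (outcomes X (parents G v - I) I x) x (parents G v \<inter> I))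
        = outcome X v (parents G v) y" for G
        by (intro outcome_cong) (auto simp: y_def override_on_def outcomes_def)
      ultimately show ?case
        using elim(3) by simp
    qed
  qed
  moreover have "indep_vars S (\<lambda>v X. outcome X v (parents E v) x) UNIV"
    if x: "x \<in> space (PiM UNIV S)" for x
  proof (rule indep_vars_cong_AE[OF ind[OF x]])
    show "AE X in P. outcome X v (parents D v) x = outcome X v (parents E v) x" for v
      using eq[OF x, of v] by eventually_elim simp
  qed (auto intro: measurable_outcome[OF law x])
  ultimately show "P \<in> dag_model S E"
    using ground unfolding dag_model_def by blast
qed

section \<open>A deterministic schedule with a single edge\<close>

text \<open>\<open>c\<close> gives the default values and \<open>b\<close> the reaction of
  \<open>v\<close>. The outcome of \<open>u\<close> is always \<open>c u\<close>, even under an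
  intervention on \<open>u\<close>, so only an imposed value can trigger the reaction.\<close>

definition edge_schedule ::
  "('v \<Rightarrow> 'a measure) \<Rightarrow> 'v \<Rightarrow> 'v \<Rightarrow> ('v \<Rightarrow> 'a) \<Rightarrow> 'a \<Rightarrow> ('v, 'a) schedule" where
  "edge_schedule S u v c b = restrict
     (\<lambda>(w, I, x). if w = v \<and> u \<in> I \<and> x u \<noteq> c u then b else c w)
     (SIGMA w:UNIV. SIGMA I:UNIV. space (PiM I S))"

section \<open>Point masses on a single schedule\<close>

text \<open>With one sample point and its power set as sigma-algebra, a map is measurable as soon as
  its single value lies in the target space.\<close>

definition dirac_law :: "('v, 'a) schedule \<Rightarrow> ('v, 'a) schedule measure" where
  "dirac_law X = return (count_space {X}) X"

lemma prob_space_dirac_law: "prob_space (dirac_law X)"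
  by (simp add: dirac_law_def prob_space_return)

lemma space_dirac_law [simp]: "space (dirac_law X) = {X}"
  by (simp add: dirac_law_def)

lemma sets_dirac_law [simp]: "sets (dirac_law X) = Pow {X}"
  by (simp add: dirac_law_def)

lemma AE_dirac_law [simp]: "(AE Y in dirac_law X. Q Y) \<longleftrightarrow> Q X"
  unfolding dirac_law_def by (subst AE_return) auto

lemma emeasure_dirac_law: "A \<subseteq> {X} \<Longrightarrow> emeasure (dirac_law X) A = indicator A X"
  by (simp add: dirac_law_def)

text \<open>Every event has probability 0 or 1, and the indicator of an intersection is the product
  of the indicators.\<close>

lemma indep_vars_dirac_law:
  assumes "\<And>i. f i X \<in> space (N i)"
  shows "prob_space.indep_vars (dirac_law X) N f I"
proof -
  interpret prob_space "dirac_law X"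
    by (rule prob_space_dirac_law)
  have *: "prob A = indicator A X" if "A \<subseteq> {X}" for A
    using that by (simp add: measure_def emeasure_dirac_law indicator_def)
  have "random_variable (N i) (f i)" for i
    using assms by (auto simp: measurable_def)
  then show ?thesis
    unfolding indep_vars_def2 indep_sets_def
  proof (intro conjI ballI allI impI)
    fix J A assume J: "J \<noteq> {}" "finite J"
      and "A \<in> (\<Pi> j\<in>J. {f j -` B \<inter> space (dirac_law X) |B. B \<in> sets (N j)})"
    then have A: "A j \<subseteq> {X}" if "j \<in> J" for j
      using that by (auto simp: Pi_iff)
    with J have "prob (\<Inter>j\<in>J. A j) = indicator (\<Inter>j\<in>J. A j) X"
      by (intro *) blast
    also have "\<dots> = (\<Prod>j\<in>J. indicator (A j) X)"
      using J by (cases "\<forall>j\<in>J. X \<in> A j") (auto simp: indicator_def)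
    also have "\<dots> = (\<Prod>j\<in>J. prob (A j))"
      using A by (intro prod.cong) (simp_all add: *)
    finally show "prob (\<Inter>j\<in>J. A j) = (\<Prod>j\<in>J. prob (A j))" .
  qed auto
qed

text \<open>A point of a finite product is a box of singletons. This makes the value of a
  deterministic conditioning variable a measurable event.\<close>

lemma sets_singleton_PiM:
  assumes "finite I" "y \<in> extensional I" "\<And>i. i \<in> I \<Longrightarrow> {y i} \<in> sets (M i)"
  shows "{y} \<in> sets (PiM I M)"
proof -
  have "{y} = (\<Pi>\<^sub>E i\<in>I. {y i})"
    using assms(2) by (simp add: PiE_singleton)
  also have "\<dots> \<in> sets (PiM I M)"
    using assms by (intro sets_PiM_I_finite) auto
  finally show ?thesis .
qed

text \<open>Conditioning on a constant changes nothing, so the constant kernel at the law itself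
  serves as conditional probability. Consistency then has to be checked only at the one value
  attained by the conditioning variable.\<close>

lemma consistent_dirac_law:
  fixes S :: "'v::finite \<Rightarrow> 'a measure"
  assumes S: "\<And>v. state_space (S v)"
    and X: "X \<in> schedules S"
    and cons: "\<And>I I' x. I \<inter> I' = {} \<Longrightarrow> x \<in> space (PiM UNIV S) \<Longrightarrow>
      outcomes X UNIV (I \<union> I') (override_on x (outcomes X I' I x) I') = outcomes X UNIV I x"
  shows "consistent S (dirac_law X)"
  unfolding consistent_def
proof (intro allI impI ballI exI conjI)
  fix I I' :: "'v set" and x
  assume disj: "I \<inter> I' = {}" and x: "x \<in> space (PiM UNIV S)"
  let ?P = "dirac_law X" and ?N = "PiM I' S" and ?Y = "\<lambda>X. outcomes X I' I x"
  have val: "outcome X w I x \<in> space (S w)" for w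
    using x by (intro outcome_in_space[OF X]) (auto simp: space_PiM)
  then have Y: "?Y \<in> ?P \<rightarrow>\<^sub>M ?N"
    by (auto simp: measurable_def outcomes_def space_PiM)
  show "regular_cond_prob ?P ?N ?Y (\<lambda>_. ?P)"
    unfolding regular_cond_prob_def
  proof (intro conjI ballI)
    show "(\<lambda>_. ?P) \<in> ?N \<rightarrow>\<^sub>M prob_algebra ?P"
      by (intro measurable_const) (simp add: space_prob_algebra prob_space_dirac_law)
    fix A B assume A: "A \<in> sets ?P" and B: "B \<in> sets ?N"
    \<comment> \<open>The integrand is constant on \<open>B\<close>, so the integral is a product of
      two probabilities; for a point mass this is the probability of the intersection.\<close>
    have "(\<integral>\<^sup>+y\<in>B. emeasure ?P A \<partial>distr ?P ?N ?Y) = emeasure ?P A * emeasure (distr ?P ?N ?Y) B"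
      using B by (simp add: nn_integral_cmult_indicator)
    also have "\<dots> = emeasure ?P A * emeasure ?P (?Y -` B \<inter> space ?P)"
      using Y B by (simp add: emeasure_distr)
    also have "\<dots> = emeasure ?P (A \<inter> (?Y -` B \<inter> space ?P))"
    proof -
      have "A \<subseteq> {X}" "?Y -` B \<inter> space ?P \<subseteq> {X}" "A \<inter> (?Y -` B \<inter> space ?P) \<subseteq> {X}"
        using A by auto
      then show ?thesis
        by (simp only: emeasure_dirac_law indicator_inter_arith)
    qed
    finally show "emeasure ?P (A \<inter> (?Y -` B \<inter> space ?P)) =
      (\<integral>\<^sup>+y\<in>B. emeasure ?P A \<partial>distr ?P ?N ?Y)" ..
  qed
  \<comment> \<open>Measurability of this singleton lets the law of \<open>?Y\<close> be seen to
    concentrate on it.\<close>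
  have "{?Y X} \<in> sets ?N"
    using S val by (intro sets_singleton_PiM) (auto simp: outcomes_def state_space_def)
  moreover from this have "{y \<in> space ?N. y = ?Y X} = {?Y X}"
    using sets.sets_into_space by blast
  ultimately have "AE y in distr ?P ?N ?Y. y = ?Y X"
    using Y by (subst AE_distr_iff) simp_all
  then show "AE y in distr ?P ?N ?Y. AE Z in ?P.
      outcomes Z UNIV (I \<union> I') (override_on x y I') = outcomes Z UNIV I x"
    by eventually_elim (simp add: cons[OF disj x])
qed

section \<open>The single-edge schedule as a separating example\<close>

context
  fixes S :: "'v::finite \<Rightarrow> 'a measure" and u v :: 'v and c :: "'v \<Rightarrow> 'a" and b :: 'a
  assumes S: "\<And>v. state_space (S v)"
    and c: "\<And>w. c w \<in> space (S w)"
    and b: "b \<in> space (S v)"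
    and uv: "u \<noteq> v"
begin

lemma outcome_edge_schedule:
  assumes "\<And>w. w \<in> I \<Longrightarrow> x w \<in> space (S w)"
  shows "outcome (edge_schedule S u v c b) w I x =
    (if w = v \<and> u \<in> I \<and> x u \<noteq> c u then b else c w)"
proof -
  have "restrict x I \<in> space (PiM I S)"
    using assms by (auto simp: space_PiM)
  then show ?thesis
    by (auto simp: outcome_def edge_schedule_def)
qed

lemma edge_schedule_in_schedules: "edge_schedule S u v c b \<in> schedules S"
  unfolding schedules_def edge_schedule_def using c b by (auto simp: restrict_PiE_iff)

lemma schedule_law_edge_schedule: "schedule_law S (dirac_law (edge_schedule S u v c b))"
proof -
  let ?X = "edge_schedule S u v c b"
  have meas: "(\<lambda>(X, x). outcome X w I x) \<in> dirac_law ?X \<Otimes>\<^sub>M PiM I S \<rightarrow>\<^sub>M S w" for w I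
  proof (cases "w = v \<and> u \<in> I")
    case True
    \<comment> \<open>The outcome of \<open>v\<close> is a two-valued function of \<open>x u\<close>
      that switches on this set.\<close>
    have cu: "{c u} \<in> sets (S u)"
      using S c by (auto simp: state_space_def)
    have "(\<lambda>(X, x). x u) \<in> dirac_law ?X \<Otimes>\<^sub>M PiM I S \<rightarrow>\<^sub>M S u"
      using True measurable_compose[OF measurable_snd measurable_component_singleton[of u I S]]
      by (simp add: case_prod_beta)
    moreover have "(\<lambda>y. if y \<in> {c u} then c w else b) \<in> S u \<rightarrow>\<^sub>M S w"
      using True b c cu by (intro measurable_If_set measurable_const) auto
    ultimately have "(\<lambda>p. if (case p of (X, x) \<Rightarrow> x u) \<in> {c u} then c w else b)
        \<in> dirac_law ?X \<Otimes>\<^sub>M PiM I S \<rightarrow>\<^sub>M S w"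
      by (rule measurable_compose)
    then show ?thesis
      using True by (subst measurable_cong) (auto simp: space_pair_measure space_PiM outcome_edge_schedule PiE_iff)
  next
    case False
    then have "(\<lambda>_. c w) \<in> dirac_law ?X \<Otimes>\<^sub>M PiM I S \<rightarrow>\<^sub>M S w"
      using c by simp
    then show ?thesis
      using False by (subst measurable_cong) (auto simp: space_pair_measure space_PiM outcome_edge_schedule PiE_iff)
  qed
  define differ where "differ w I J x \<longleftrightarrow>
    x \<in> space (PiM UNIV S) \<and> outcome ?X w I x \<noteq> outcome ?X w J x" for w I J x
  \<comment> \<open>One witness for each triple \<open>(w, I, J)\<close> whose outcomes differ
    somewhere; the vertex type is finite, so \<open>C\<close> is finite.\<close>
  define C where "C = (\<lambda>(w, I, J). SOME x. differ w I J x) ` {(w, I, J). \<exists>x. differ w I J x}"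
  have C: "\<exists>x\<in>C. differ w I J x" if "differ w I J x" for w I J x
  proof
    show "differ w I J (SOME y. differ w I J y)"
      by (rule someI[of "differ w I J", OF that])
    show "(SOME y. differ w I J y) \<in> C"
      using that unfolding C_def by (intro image_eqI[of _ _ "(w, I, J)"]) auto
  qed
  have "C \<subseteq> space (PiM UNIV S)"
  proof
    fix x assume "x \<in> C"
    then obtain w I J where "\<exists>y. differ w I J y" "x = (SOME y. differ w I J y)"
      unfolding C_def by auto
    then have "differ w I J x"
      using someI_ex[of "differ w I J"] by simp
    then show "x \<in> space (PiM UNIV S)"
      by (simp add: differ_def)
  qed
  moreover have "countable C"
    unfolding C_def by (intro countable_finite finite_imageI) simp
  moreover have "(\<forall>x\<in>C. outcome ?X w I x = outcome ?X w J x) \<longrightarrow>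
      (\<forall>x\<in>space (PiM UNIV S). outcome ?X w I x = outcome ?X w J x)" for w I J
    using C[of w I J] unfolding differ_def by blast
  ultimately have "\<exists>C. countable C \<and> C \<subseteq> space (PiM UNIV S) \<and>
      (AE X in dirac_law ?X. \<forall>w I J.
        (\<forall>x\<in>C. outcome X w I x = outcome X w J x) \<longrightarrow>
        (\<forall>x\<in>space (PiM UNIV S). outcome X w I x = outcome X w J x))"
    unfolding AE_dirac_law by blast
  moreover have "space (dirac_law ?X) \<subseteq> schedules S"
    using edge_schedule_in_schedules by simp
  ultimately show ?thesis
    unfolding schedule_law_def using meas prob_space_dirac_law by blast
qed

text \<open>If \<open>u\<close> is in \<open>I\<close>, the recursion passes the imposed
  \<open>x u\<close> on to \<open>v\<close>; otherwise it passes on the outcome \<open>c u\<close>,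
  which triggers nothing. All other vertices are constant.\<close>

lemma edge_schedule_in_dag_model:
  "dirac_law (edge_schedule S u v c b) \<in> dag_model S {(u, v)}"
proof -
  let ?X = "edge_schedule S u v c b"
  have val: "outcome ?X w I x \<in> space (S w)" if "x \<in> space (PiM UNIV S)" for w I x
    using that by (intro outcome_in_space[OF edge_schedule_in_schedules]) (auto simp: space_PiM)
  have "consistent S (dirac_law ?X)"
  proof (rule consistent_dirac_law[OF S edge_schedule_in_schedules])
    fix I I' :: "'v set" and x
    assume disj: "I \<inter> I' = {}" and x: "x \<in> space (PiM UNIV S)"
    have x': "x w \<in> space (S w)" for w
      using x by (auto simp: space_PiM)
    have y': "override_on x (outcomes ?X I' I x) I' w \<in> space (S w)" for w
      using val[OF x] x' by (auto simp: override_on_def outcomes_def)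
    \<comment> \<open>For \<open>u\<close> in \<open>I'\<close> the imposed value is the observed
      \<open>c u\<close>, so \<open>v\<close> does not react; for \<open>u\<close> in
      \<open>I\<close>, disjointness preserves \<open>x u\<close>.\<close>
    show "outcomes ?X UNIV (I \<union> I') (override_on x (outcomes ?X I' I x) I') = outcomes ?X UNIV I x"
      using disj uv unfolding disjoint_iff outcomes_def[of _ UNIV]
      by (auto simp: outcome_edge_schedule x' y' fun_eq_iff)
        (auto simp: override_on_def outcomes_def outcome_edge_schedule x')
  qed
  then have "dirac_law ?X \<in> ground_model S"
    by (simp add: ground_model_def schedule_law_edge_schedule)
  moreover have "outcome ?X w I x = outcome ?X w (parents {(u, v)} w)
      (override_on (outcomes ?X (parents {(u, v)} w - I) I x) x (parents {(u, v)} w \<inter> I))"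
    if x: "x \<in> space (PiM UNIV S)" for w I x
  proof -
    have x': "x w \<in> space (S w)" for w
      using x by (auto simp: space_PiM)
    have "override_on (outcomes ?X (parents {(u, v)} w - I) I x) x (parents {(u, v)} w \<inter> I) z
        \<in> space (S z)" if "z \<in> parents {(u, v)} w" for z
      using val[OF x] x' that by (auto simp: override_on_def outcomes_def)
    then show ?thesis
      using uv by (auto simp: outcome_edge_schedule x')
        (auto simp: override_on_def outcomes_def outcome_edge_schedule x' parents_def split: if_splits)
  qed
  moreover have "prob_space.indep_vars (dirac_law ?X) S (\<lambda>w X. outcome X w (parents {(u, v)} w) x) UNIV"
    if "x \<in> space (PiM UNIV S)" for x
    using val[OF that] by (intro indep_vars_dirac_law)
  ultimately show ?thesis
    unfolding dag_model_def by auto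
qed

text \<open>Imposing \<open>a\<close> on \<open>u\<close> alone moves \<open>v\<close> to
  \<open>b\<close>, while the recursion for \<open>D\<close> does not read \<open>u\<close> and
  predicts \<open>c v\<close>.\<close>

lemma edge_schedule_notin_dag_model:
  assumes "(u, v) \<notin> D" "a \<in> space (S u)" "a \<noteq> c u" "b \<noteq> c v"
  shows "dirac_law (edge_schedule S u v c b) \<notin> dag_model S D"
proof
  let ?X = "edge_schedule S u v c b" and ?x = "c(u := a)"
  assume "dirac_law ?X \<in> dag_model S D"
  moreover have x: "?x w \<in> space (S w)" for w
    using assms(2) c by simp
  then have "?x \<in> space (PiM UNIV S)"
    by (auto simp: space_PiM)
  ultimately have "outcome ?X v {u} ?x = outcome ?X v (parents D v)
      (override_on (outcomes ?X (parents D v - {u}) {u} ?x) ?x (parents D v \<inter> {u}))"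
    unfolding dag_model_def by fastforce
  moreover have "outcome ?X v {u} ?x = b"
    using assms(2,3) by (subst outcome_edge_schedule) auto
  moreover have "outcome ?X v (parents D v)
      (override_on (outcomes ?X (parents D v - {u}) {u} ?x) ?x (parents D v \<inter> {u})) = c v"
    using assms(1,2) x
    by (subst outcome_edge_schedule)
      (auto simp: parents_def override_on_def outcomes_def
        intro!: outcome_in_space[OF edge_schedule_in_schedules])
  ultimately show False
    using assms(4) by simp
qed

end

section \<open>Model inclusion is edge inclusion\<close>

lemma state_space_two_points:
  assumes "state_space M"
  obtains a b where "a \<in> space M" "b \<in> space M" "a \<noteq> b"
proof -
  \<comment> \<open>\<open>card\<close> is 0 on infinite sets, so the infinite case is kept
    apart.\<close>
  have "\<not> card (space M) \<le> Suc 0 \<or> infinite (space M)"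
    using assms by (auto simp: state_space_def)
  then show ?thesis
    using that card_le_Suc0_iff_eq[of "space M"] finite.emptyI
    by (metis card.empty finite_subset finite.insertI singleton_iff subsetI zero_le)
qed

lemma dag_model_subset_iff:
  fixes S :: "'v::finite \<Rightarrow> 'a measure"
  assumes S: "\<And>v. state_space (S v)" and D: "acyclic D"
  shows "dag_model S D \<subseteq> dag_model S E \<longleftrightarrow> D \<subseteq> E"
proof
  assume sub: "dag_model S D \<subseteq> dag_model S E"
  show "D \<subseteq> E"
  proof (intro subrelI, rule ccontr)
    fix u v assume uv: "(u, v) \<in> D" "(u, v) \<notin> E"
    then have "u \<noteq> v"
      using D by (auto simp: acyclic_def)
    \<comment> \<open>Two values per vertex: \<open>c\<close> is the default, \<open>d u\<close> the
      imposed value that triggers the reaction, and \<open>d v\<close> the reaction.\<close>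
    have "\<exists>a b. a \<in> space (S w) \<and> b \<in> space (S w) \<and> a \<noteq> b" for w
      using state_space_two_points[OF S] by metis
    then obtain c d where cd: "\<And>w. c w \<in> space (S w)" "\<And>w. d w \<in> space (S w)" "\<And>w. c w \<noteq> d w"
      by metis
    have "dirac_law (edge_schedule S u v c (d v)) \<in> dag_model S {(u, v)}"
      using edge_schedule_in_dag_model[of S c "d v" v u] S cd \<open>u \<noteq> v\<close> by blast
    moreover have "dag_model S {(u, v)} \<subseteq> dag_model S D"
      using uv by (intro dag_model_mono) simp
    moreover have "dirac_law (edge_schedule S u v c (d v)) \<notin> dag_model S E"
      using edge_schedule_notin_dag_model[of S c "d v" v u E "d u"] S cd \<open>u \<noteq> v\<close> uv by metis
    ultimately show False
      using sub by blast
  qed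
qed (rule dag_model_mono)

section \<open>Acyclic relations ordered by inclusion\<close>

text \<open>From here on only the order matters: \<open>L\<close> is any order on acyclic relations
  that agrees with inclusion, and causal models no longer occur.\<close>

context
  fixes L :: "'v::finite rel gorder"
  assumes carrier_L: "carrier L = {D. acyclic D}"
    and eq_L: "(.=\<^bsub>L\<^esub>) = (=)"
    and le_L: "\<And>D E. acyclic D \<Longrightarrow> D \<sqsubseteq>\<^bsub>L\<^esub> E \<longleftrightarrow> D \<subseteq> E"
begin

lemma partial_order_acyclic: "partial_order L"
  by unfold_locales (auto simp: carrier_L eq_L le_L)

lemma less_acyclic_iff: "acyclic D \<Longrightarrow> D \<sqsubset>\<^bsub>L\<^esub> E \<longleftrightarrow> D \<subset> E"
  by (auto simp: lless_def eq_L le_L)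

text \<open>Subgraphs of acyclic graphs are acyclic, so adding to \<open>D\<close> one missing edge
  of \<open>E\<close> stays in the carrier and must already give \<open>E\<close>. Conversely,
  cardinalities leave no room between.\<close>

lemma covered_by_acyclic_iff:
  assumes "acyclic D" "acyclic E"
  shows "covered_by L D E \<longleftrightarrow> D \<subseteq> E \<and> card E = card D + 1"
proof
  assume cov: "covered_by L D E"
  then have "D \<subset> E"
    using assms by (simp add: covered_by_def less_acyclic_iff)
  then obtain e where e: "e \<in> E" "e \<notin> D"
    by blast
  have "acyclic (insert e D)"
    using acyclic_subset[OF assms(2), of "insert e D"] e \<open>D \<subset> E\<close> by blast
  then have "\<not> (D \<subset> insert e D \<and> insert e D \<subset> E)"
    using cov assms by (auto simp: covered_by_def carrier_L less_acyclic_iff)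
  then have "E = insert e D"
    using e \<open>D \<subset> E\<close> by blast
  then show "D \<subseteq> E \<and> card E = card D + 1"
    using e by auto
next
  assume DE: "D \<subseteq> E \<and> card E = card D + 1"
  then have "\<not> (D \<subset> F \<and> F \<subset> E)" for F
    using psubset_card_mono[of F D] psubset_card_mono[of E F] by force
  moreover have "D \<noteq> E"
    using DE by auto
  ultimately show "covered_by L D E"
    using assms DE by (auto simp: covered_by_def carrier_L less_acyclic_iff)
qed

lemma covered_by_remove_edge:
  assumes "acyclic D" "e \<in> D"
  shows "covered_by L (D - {e}) D"
proof -
  have "acyclic (D - {e})"
    using assms(1) by (rule acyclic_subset) blast
  then show ?thesis
    using assms card_Suc_Diff1[of D e] by (simp add: covered_by_acyclic_iff)
qed

lemma acyclic_empty_rel: "acyclic ({} :: 'v rel)"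
  by (simp add: acyclic_def)

text \<open>\<open>D\<close> is built edge by edge; the intermediate graphs are acyclic as subgraphs
  of \<open>D\<close>. Any two graphs are later joined through the empty one.\<close>

lemma empty_connected:
  assumes "acyclic D"
  shows "({}, D) \<in> {(D, E). covered_by L D E \<or> covered_by L E D}\<^sup>*"
  using finite[of D] assms
proof (induction D rule: finite_induct)
  case (insert e D)
  have "acyclic D"
    using insert.prems by (rule acyclic_subset) blast
  moreover have "covered_by L D (insert e D)"
    using covered_by_remove_edge[OF insert.prems, of e] insert.hyps by simp
  ultimately show ?case
    using insert.IH by (auto intro: rtrancl_into_rtrancl)
qed simp

lemma connected_poset_acyclic: "connected_poset L"
proof -
  let ?R = "{(D, E). covered_by L D E \<or> covered_by L E D}"
  have "sym (?R\<^sup>*)"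
    by (intro sym_rtrancl) (auto simp: sym_def)
  then have "(D, E) \<in> ?R\<^sup>*" if "acyclic D" "acyclic E" for D E
    using empty_connected[OF that(1)] empty_connected[OF that(2)]
    by (meson rtrancl_trans symD)
  then show ?thesis
    by (simp add: connected_poset_def partial_order_acyclic carrier_L)
qed

lemma graded_poset_acyclic: "graded_poset L card"
proof -
  have "card E = card D + 1" if "covered_by L D E" for D E
    using that covered_by_acyclic_iff[of D E] by (simp add: covered_by_def carrier_L)
  moreover have "\<exists>D\<in>carrier L. \<not> (\<exists>E\<in>carrier L. E \<sqsubset>\<^bsub>L\<^esub> D) \<and> card D = 0"
    by (intro bexI[of _ "{}"]) (auto simp: carrier_L less_acyclic_iff acyclic_empty_rel)
  ultimately show ?thesis
    by (simp add: graded_poset_def connected_poset_acyclic)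
qed

lemma least_empty_acyclic: "least L {} (carrier L)"
  by (simp add: least_def carrier_L le_L acyclic_empty_rel)

text \<open>A greatest graph would contain both \<open>(u, v)\<close> and \<open>(v, u)\<close>, a
  cycle.\<close>

lemma no_greatest_acyclic:
  assumes "CARD('v) > 1"
  shows "\<not> greatest L D (carrier L)"
proof
  assume D: "greatest L D (carrier L)"
  then have "acyclic D"
    by (simp add: greatest_def carrier_L)
  have "\<not> card (UNIV :: 'v set) \<le> Suc 0"
    using assms by simp
  then obtain u v :: 'v where "u \<noteq> v"
    by (auto simp: card_le_Suc0_iff_eq)
  then have "acyclic {(u, v)}" "acyclic {(v, u)}"
    by (auto simp: acyclic_empty_rel)
  then have "(u, v) \<in> D" "(v, u) \<in> D"
    using D unfolding greatest_def carrier_L by (metis le_L insert_subset mem_Collect_eq)+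
  then show False
    using \<open>acyclic D\<close> by (meson acyclic_def trancl.simps)
qed

text \<open>The meet is the intersection of the edge sets, acyclic as a subgraph.\<close>

lemma lower_semilattice_acyclic: "lower_semilattice L"
proof (intro lower_semilattice.intro lower_semilattice_axioms.intro partial_order_acyclic)
  fix D E assume DE: "D \<in> carrier L" "E \<in> carrier L"
  then have "acyclic (D \<inter> E)"
    using acyclic_subset[of D "D \<inter> E"] by (simp add: carrier_L)
  moreover have "F \<in> Lower L {D, E} \<longleftrightarrow> acyclic F \<and> F \<subseteq> D \<inter> E" for F
  \<comment> \<open>\<open>le_L\<close> needs an acyclic left argument; for any other
    \<open>F\<close> both sides are false.\<close>
  proof (cases "acyclic F")
    case True
    then show ?thesis
      using DE le_L[OF True] by (simp add: Lower_def carrier_L) blast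
  next
    case False
    then show ?thesis
      by (simp add: Lower_def carrier_L)
  qed
  ultimately have "greatest L (D \<inter> E) (Lower L {D, E})"
    by (auto simp: greatest_def carrier_L le_L)
  then show "\<exists>F. greatest L F (Lower L {D, E})"
    by blast
qed

text \<open>The distinct graphs \<open>D\<close> and \<open>E\<close> each lack one edge of
  \<open>F\<close>, so their union has as many edges as \<open>F\<close>. By inclusion-exclusion
  \<open>D \<inter> E\<close> has one edge less than each.\<close>

lemma lower_semimodular_acyclic: "lower_semimodular L"
  unfolding lower_semimodular_def
proof (intro allI impI, elim conjE)
  fix D E F assume cov: "covered_by L D F" "covered_by L E F" and ne: "D \<noteq> E"
  then have ac: "acyclic D" "acyclic E" "acyclic F"
    by (auto simp: covered_by_def carrier_L)
  then have D: "D \<subseteq> F" "card F = card D + 1" and E: "E \<subseteq> F" "card F = card E + 1"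
    using cov by (auto simp: covered_by_acyclic_iff)
  have "D \<subset> D \<union> E"
    using D E ne card_subset_eq[of D E] by auto
  then have "card D < card (D \<union> E)"
    by (intro psubset_card_mono) auto
  moreover have "card (D \<union> E) \<le> card F"
    using D E by (intro card_mono) auto
  moreover have "card D + card E = card (D \<union> E) + card (D \<inter> E)"
    by (intro card_Un_Int) auto
  moreover have "acyclic (D \<inter> E)"
    using ac(1) by (rule acyclic_subset) blast
  ultimately have "covered_by L (D \<inter> E) D" "covered_by L (D \<inter> E) E"
    using D E ac by (auto simp: covered_by_acyclic_iff)
  then show "\<exists>W. covered_by L W D \<and> covered_by L W E"
    by blast
qed

end

theorem theorem3:
  fixes S :: "'v::finite \<Rightarrow> 'a measure"
  assumes "\<And>v. state_space (S v)"
  shows "partial_order (dag_poset S)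
    \<and> least (dag_poset S) {} (carrier (dag_poset S))
    \<and> (CARD('v) > 1 \<longrightarrow> \<not> (\<exists>D. greatest (dag_poset S) D (carrier (dag_poset S))))
    \<and> graded_poset (dag_poset S) card
    \<and> (\<forall>D\<^sub>1\<in>carrier (dag_poset S). \<forall>D\<^sub>2\<in>carrier (dag_poset S).
         covered_by (dag_poset S) D\<^sub>1 D\<^sub>2 \<longleftrightarrow> D\<^sub>1 \<subseteq> D\<^sub>2 \<and> card D\<^sub>2 = card D\<^sub>1 + 1)
    \<and> lower_semilattice (dag_poset S)
    \<and> lower_semimodular (dag_poset S)"
proof -
  \<comment> \<open>These facts discharge the assumptions on \<open>L\<close>; the last one carries
    all that is used about causal models.\<close>
  have L: "carrier (dag_poset S) = {D. acyclic D}" "(.=\<^bsub>dag_poset S\<^esub>) = (=)"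
    "\<And>D E. acyclic D \<Longrightarrow> D \<sqsubseteq>\<^bsub>dag_poset S\<^esub> E \<longleftrightarrow> D \<subseteq> E"
    using dag_model_subset_iff[OF assms] by (simp_all add: dag_poset_def)
  show ?thesis
    using partial_order_acyclic[OF L] least_empty_acyclic[OF L] no_greatest_acyclic[OF L]
      graded_poset_acyclic[OF L] covered_by_acyclic_iff[OF L] lower_semilattice_acyclic[OF L]
      lower_semimodular_acyclic[OF L]
    by (simp add: L(1))
qed

end
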